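(* Let $\mathcal{G}$ be the ensemble of hard random geometric graphs with $n=3$ nodes, independently and uniformly distributed on the one-dimensional unit torus $\mathbb{T}=\mathbb{R}/\mathbb{Z}$, with connection radius $r_0\ge 0$. Put $$H_{\mathbb{T}}^<(r_0)=-(1-3r_0)^2\log\left((1-3r_0)^2\right)-3(2r_0-5r_0^2)\log(2r_0-5r_0^2)-3r_0^2\log(r_0^2)-3r_0^2\log(3r_0^2)$$ and $$H_{\mathbb{T}}^>(r_0)=-(12r_0^2-6r_0+1)\log(12r_0^2-6r_0+1)-3(6r_0-1-8r_0^2)\log(6r_0-1-8r_0^2)-3(2r_0-1)^2\log\left((2r_0-1)^2\right).$$ Then $$H(\mathcal{G})=\begin{cases}H_{\mathbb{T}}^<(r_0) & 0<r_0<1/3,\\ H_{\mathbb{T}}^>(r_0) & 1/3\le r_0\le 1/2,\\ 0&\text{otherwise.}\end{cases}$$ Moreover $H(\mathcal{G})$ is maximised in $r_0$ at $r_0=\frac14$, so that the entropy-maximising average connection probability is $\bar p_{max}=\frac12$.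
   Context: The metric on $\mathbb{T}$ (points represented in $[0,1]$) is $\rho_T(x,y)=\min(|x-y|,1-|x-y|)$. The hard random geometric graph with connection radius $r_0$ has vertex set $\{1,2,3\}$, positions $X_1,X_2,X_3$, and an edge $(i,j)$ present if and only if $\rho_T(X_i,X_j)\le r_0$. The entropy is $H(\mathcal{G})=-\sum_g\mathbb{P}(g)\log\mathbb{P}(g)$, the sum being over the labelled graphs $g$ on $\{1,2,3\}$, with logarithm to base 2 and the convention $0\log0=0$. The average connection probability is $\bar p(r_0)=\mathbb{P}(\rho_T(X_1,X_2)\le r_0)$, and $\bar p_{max}=\bar p(\hat r_0)$, where $\hat r_0$ is the value of $r_0$ maximising $H(\mathcal{G})$. *)

theory Defs
  imports "HOL-Probability.Probability"
begin

definition torus_dist :: "real \<Rightarrow> real \<Rightarrow> real" where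
  "torus_dist x y = min \<bar>x - y\<bar> (1 - \<bar>x - y\<bar>)"

text \<open>A labelled simple graph on a fixed vertex set \<open>V\<close> is identified with its edge set,
  whose members are two-element subsets of \<open>V\<close>.\<close>

definition labelled_graphs :: "'v set \<Rightarrow> 'v set set set" where
  "labelled_graphs V = Pow {e. e \<subseteq> V \<and> card e = 2}"

definition hard_rgg :: "'v set \<Rightarrow> ('v \<Rightarrow> 'a \<Rightarrow> real) \<Rightarrow> real \<Rightarrow> 'a \<Rightarrow> 'v set set" where
  "hard_rgg V X r \<omega> =
     {{i, j} | i j. i \<in> V \<and> j \<in> V \<and> i \<noteq> j \<and> torus_dist (X i \<omega>) (X j \<omega>) \<le> r}"

definition graph_prob ::
    "'a measure \<Rightarrow> 'v set \<Rightarrow> ('v \<Rightarrow> 'a \<Rightarrow> real) \<Rightarrow> real \<Rightarrow> 'v set set \<Rightarrow> real" where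
  "graph_prob M V X r g = measure M {\<omega> \<in> space M. hard_rgg V X r \<omega> = g}"

text \<open>The convention \<open>0 log 0 = 0\<close> holds automatically, since \<^const>\<open>log\<close> is total and \<open>0 * x = 0\<close>.\<close>

definition graph_entropy :: "'a measure \<Rightarrow> 'v set \<Rightarrow> ('v \<Rightarrow> 'a \<Rightarrow> real) \<Rightarrow> real \<Rightarrow> real" where
  "graph_entropy M V X r =
     - (\<Sum>g\<in>labelled_graphs V. graph_prob M V X r g * log 2 (graph_prob M V X r g))"

definition avg_connection_prob :: "'a measure \<Rightarrow> (nat \<Rightarrow> 'a \<Rightarrow> real) \<Rightarrow> real \<Rightarrow> real" where
  "avg_connection_prob M X r = measure M {\<omega> \<in> space M. torus_dist (X 1 \<omega>) (X 2 \<omega>) \<le> r}"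

text \<open>The definite description is meaningful only if the maximiser is unique.\<close>

definition max_connection_prob :: "'a measure \<Rightarrow> nat set \<Rightarrow> (nat \<Rightarrow> 'a \<Rightarrow> real) \<Rightarrow> real" where
  "max_connection_prob M V X =
     avg_connection_prob M X (THE r. is_arg_max (graph_entropy M V X) (\<lambda>r. 0 \<le> r) r)"

definition H_less :: "real \<Rightarrow> real" where
  "H_less r =
     - ((1 - 3 * r)^2 * log 2 ((1 - 3 * r)^2))
     - 3 * (2 * r - 5 * r^2) * log 2 (2 * r - 5 * r^2)
     - 3 * r^2 * log 2 (r^2)
     - 3 * r^2 * log 2 (3 * r^2)"

definition H_greater :: "real \<Rightarrow> real" where
  "H_greater r =
     - ((12 * r^2 - 6 * r + 1) * log 2 (12 * r^2 - 6 * r + 1))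
     - 3 * (6 * r - 1 - 8 * r^2) * log 2 (6 * r - 1 - 8 * r^2)
     - 3 * (2 * r - 1)^2 * log 2 ((2 * r - 1)^2)"

end

theory Submission
  imports Defs "HOL-Real_Asymp.Real_Asymp"
begin

text \<open>Seen from the first point, the displacements to the two others are independent and uniform on
  \<open>[-1/2, 1/2]\<close>. This gives the probabilities \<open>2r\<close> of an edge, \<open>4r\<^sup>2\<close> of two given edges and, for
  \<open>r < 1/2\<close>, \<open>3r\<^sup>2 + (max 0 (3r - 1))\<^sup>2\<close> of a triangle; inclusion and exclusion yields the
  probabilities of all eight graphs.

  On \<open>(0, 1/3)\<close> the entropy is not concave, but its derivative is convex. The derivative vanishes
  at \<open>1/4\<close> and is negative near \<open>1/3\<close>, so it is positive before \<open>1/4\<close> and negative after. On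
  \<open>[1/3, 1/2]\<close> the entropy is at most the cross entropy relative to the distribution at
  \<open>r = 1/3\<close>, hence at most \<open>5/3 log 3\<close>, which is below the value \<open>4 - 3/4 log 3\<close> at \<open>1/4\<close>.\<close>

section \<open>Maximising the entropy formulas\<close>

text \<open>One sixth of the derivative of \<open>ln 2 * H_less\<close>. The terms without a
  logarithm that the product rule creates cancel.\<close>

definition H_less_slope :: "real \<Rightarrow> real" where
  "H_less_slope r =
     2 * (1 - 3 * r) * ln (1 - 3 * r) - (1 - r) * ln r - (1 - 5 * r) * ln (2 - 5 * r) - r * ln 3"

text \<open>Natural logarithms of products are split so that only \<open>ln (1 - 3 * r)\<close>,
  \<open>ln r\<close>, \<open>ln (2 - 5 * r)\<close> and \<open>ln 3\<close> remain, a form that is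
  easy to differentiate.\<close>

lemma ln2_mult_H_less:
  assumes "0 < r" "r < 1/3"
  shows "ln 2 * H_less r =
    - 2 * (1 - 3 * r)^2 * ln (1 - 3 * r) - (6 * r - 3 * r^2) * ln r
      - 3 * (2 * r - 5 * r^2) * ln (2 - 5 * r) - 3 * r^2 * ln 3"
proof -
  have 1: "ln ((1 - 3 * r)^2) = 2 * ln (1 - 3 * r)" "ln (r^2) = 2 * ln r"
    using assms by (simp_all add: ln_realpow)
  have 2: "ln (3 * r^2) = ln 3 + 2 * ln r"
    using assms by (simp add: ln_mult ln_realpow)
  have "2 * r - 5 * r^2 = r * (2 - 5 * r)"
    by (simp add: power2_eq_square algebra_simps)
  then have 3: "ln (2 * r - 5 * r^2) = ln r + ln (2 - 5 * r)"
    using assms by (simp add: ln_mult)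
  have log: "ln 2 * log 2 x = ln x" for x :: real
    by (simp add: log_def)
  have "ln 2 * H_less r = - ((1 - 3 * r)^2 * (ln 2 * log 2 ((1 - 3 * r)^2)))
     - 3 * (2 * r - 5 * r^2) * (ln 2 * log 2 (2 * r - 5 * r^2))
     - 3 * r^2 * (ln 2 * log 2 (r^2))
     - 3 * r^2 * (ln 2 * log 2 (3 * r^2))"
    unfolding H_less_def by (simp add: algebra_simps)
  then show ?thesis
    unfolding log 1 2 3 by (simp add: algebra_simps)
qed

lemma has_real_derivative_H_less:
  assumes "0 < r" "r < 1/3"
  shows "((\<lambda>r. ln 2 * H_less r) has_real_derivative 6 * H_less_slope r) (at r)"
proof -
  have "((\<lambda>r. - 2 * (1 - 3 * r)^2 * ln (1 - 3 * r) - (6 * r - 3 * r^2) * ln r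
      - 3 * (2 * r - 5 * r^2) * ln (2 - 5 * r) - 3 * r^2 * ln 3)
      has_real_derivative 6 * H_less_slope r) (at r)"
    unfolding H_less_slope_def using assms
    by (auto intro!: derivative_eq_intros simp: divide_simps power2_eq_square) (simp_all add: algebra_simps)
  then show ?thesis
    by (rule has_field_derivative_transform_within_open[where S = "{0<..<1/3}"])
      (use assms in \<open>simp_all add: ln2_mult_H_less\<close>)
qed

text \<open>The expression is the second derivative of \<open>H_less_slope\<close>. Up to 1/5 each
  negative term is dominated by a single positive one. Beyond 1/5 the negative terms are merged with
  \<open>18 / (1 - 3 * r)\<close> into one fraction, and \<open>1 / r + 1 / r^2\<close> makes up for
  its possibly negative numerator.\<close>

lemma H_less_slope_second_derivative_nonneg:
  fixes r :: real
  assumes "0 < r" "r < 1/3"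
  shows "0 \<le> 18 / (1 - 3 * r) + 1 / r + 1 / r^2 - 25 / (2 - 5 * r) - 25 / (2 - 5 * r)^2"
proof -
  have pos: "0 < 1 - 3 * r" "0 < 2 - 5 * r" using assms by auto
  show ?thesis
  proof (cases "r \<le> 1/5")
    case True
    have "25 / (2 - 5 * r) \<le> 18 / (1 - 3 * r)"
      using assms pos by (simp add: field_simps)
    \<comment> \<open>This amounts to \<open>5 * r \<le> 2 - 5 * r\<close>, whence the split at
      1/5.\<close>
    moreover have "25 / (2 - 5 * r)^2 \<le> 1 / r^2"
    proof -
      have "(5 * r)^2 \<le> (2 - 5 * r)^2" using assms True by (intro power_mono) auto
      then show ?thesis using assms pos by (simp add: divide_simps power_mult_distrib)
    qed
    moreover have "0 < 1 / r" using assms by simp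
    ultimately show ?thesis by linarith
  next
    case False
    define P where "P = (1 - 3 * r) * (2 - 5 * r)^2"
    have P: "0 < P" unfolding P_def using pos by simp
    have eq: "18 / (1 - 3 * r) - 25 / (2 - 5 * r) - 25 / (2 - 5 * r)^2 = (75 * r^2 - 10 * r - 3) / P"
      unfolding P_def using pos by (simp add: divide_simps) (simp add: algebra_simps power2_eq_square)
    have quad: "75 * r^2 - 10 * r - 3 = 75 * ((r - 1/15)^2) - 10/3"
      by (simp add: power2_eq_square algebra_simps)
    have mono: "75 * ((a - 1/15)^2) - 10/3 \<le> 75 * r^2 - 10 * r - 3" if "1/15 \<le> a" "a \<le> r" for a
      unfolding quad using that by (simp add: power_mono)
    have "0 \<le> 75 * r^2 - 10 * r - 3 + P * (1 / r + 1 / r^2)"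
    proof -
      \<comment> \<open>On the first two pieces the increasing quadratic is bounded by its value at
        the left end, and the decreasing factors \<open>P\<close> and \<open>1 / r + 1 / r^2\<close>
        by their values at the right end. The point 7/25 lies just beyond the positive root of the
        quadratic.\<close>
      consider "r \<le> 1/4" | "1/4 \<le> r" "r \<le> 7/25" | "7/25 \<le> r" by linarith
      then show ?thesis
      proof cases
        case 1
        have "- 2 \<le> 75 * r^2 - 10 * r - 3" using mono[of "1/5"] False by (simp add: power2_eq_square)
        moreover have "(1/4) * (3/4)^2 \<le> P"
          unfolding P_def using 1 by (intro mult_mono power_mono) auto
        moreover have "20 \<le> 1 / r + 1 / r^2"
        proof -
          have "4 \<le> 1 / r" using 1 assms by (simp add: field_simps)
          moreover from power_mono[OF this, of 2] have "16 \<le> 1 / r^2" by (simp add: power_divide)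
          ultimately show ?thesis by linarith
        qed
        ultimately have "(1/4) * (3/4)^2 * 20 \<le> P * (1 / r + 1 / r^2)"
          using P by (intro mult_mono) auto
        moreover have "2 \<le> (1/4) * (3/4)^2 * (20 :: real)" by (simp add: power2_eq_square)
        ultimately show ?thesis using \<open>- 2 \<le> _\<close> by linarith
      next
        case 2
        have "- 13/16 \<le> 75 * r^2 - 10 * r - 3" using mono[of "1/4"] 2 by (simp add: power2_eq_square)
        moreover have "(4/25) * (3/5)^2 \<le> P"
          unfolding P_def using 2 by (intro mult_mono power_mono) auto
        moreover have "25/7 + (25/7)^2 \<le> 1 / r + 1 / r^2"
        proof -
          have "25/7 \<le> 1 / r" using 2 assms by (simp add: field_simps)
          moreover from power_mono[OF this, of 2] have "(25/7)^2 \<le> 1 / r^2" by (simp add: power_divide)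
          ultimately show ?thesis by linarith
        qed
        ultimately have "(4/25) * (3/5)^2 * (25/7 + (25/7)^2) \<le> P * (1 / r + 1 / r^2)"
          using P by (intro mult_mono) auto
        moreover have "13/16 \<le> (4/25) * (3/5)^2 * (25/7 + (25/7)^2 :: real)"
          by (simp add: power2_eq_square)
        ultimately show ?thesis using \<open>- 13/16 \<le> _\<close> by linarith
      next
        case 3
        have "0 \<le> 75 * r^2 - 10 * r - 3" using mono[of "7/25"] 3 by (simp add: power2_eq_square)
        moreover have "0 \<le> P * (1 / r + 1 / r^2)" using P assms by simp
        ultimately show ?thesis by linarith
      qed
    qed
    then have "0 \<le> (75 * r^2 - 10 * r - 3 + P * (1 / r + 1 / r^2)) / P"
      using P by simp
    also have "\<dots> = (75 * r^2 - 10 * r - 3) / P + (1 / r + 1 / r^2)"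
      using P by (simp add: add_divide_distrib)
    finally show ?thesis unfolding eq[symmetric] by linarith
  qed
qed

lemma convex_on_H_less_slope: "convex_on {0<..<1/3} H_less_slope"
proof (rule f''_ge0_imp_convex)
  fix r :: real assume r: "r \<in> {0<..<1/3}"
  show "(H_less_slope has_real_derivative
      (- 6 * ln (1 - 3 * r) + ln r - inverse r + 5 * ln (2 - 5 * r)
        - 5 * inverse (2 - 5 * r) - ln 3)) (at r)"
    unfolding H_less_slope_def [abs_def] using r
    by (auto intro!: derivative_eq_intros simp: divide_simps) (simp_all add: algebra_simps)
  show "((\<lambda>r. - 6 * ln (1 - 3 * r) + ln r - inverse r + 5 * ln (2 - 5 * r)
        - 5 * inverse (2 - 5 * r) - ln 3) has_real_derivative
      (18 / (1 - 3 * r) + 1 / r + 1 / r^2 - 25 / (2 - 5 * r) - 25 / (2 - 5 * r)^2)) (at r)"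
    using r by (auto intro!: derivative_eq_intros simp: power2_eq_square inverse_eq_divide)
  show "0 \<le> 18 / (1 - 3 * r) + 1 / r + 1 / r^2 - 25 / (2 - 5 * r) - 25 / (2 - 5 * r)^2"
    using r by (intro H_less_slope_second_derivative_nonneg) auto
qed simp

lemma H_less_slope_quarter: "H_less_slope (1/4) = 0"
proof -
  have "ln (3/4 :: real) = ln 3 - ln 4" "ln (1/4 :: real) = - ln 4"
    by (simp_all add: ln_div)
  then show ?thesis by (simp add: H_less_slope_def field_simps)
qed

lemma eventually_H_less_slope_neg: "\<forall>\<^sub>F r in at_left (1/3). H_less_slope r < 0"
proof -
  \<comment> \<open>The term \<open>(1 - 3 * r) * ln (1 - 3 * r)\<close> vanishes in the limit, the
    two logarithms of 1/3 cancel, and a negative number is left.\<close>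
  have "(H_less_slope \<longlongrightarrow> - (2/3) * ln (1/3) + (2/3) * ln (1/3) - (1/3) * ln 3) (at_left (1/3))"
    unfolding H_less_slope_def by real_asymp
  then show ?thesis
    by (rule order_tendstoD) auto
qed

text \<open>By convexity the graph lies below the chord from 1/4, where the value is zero, to a
  point \<open>s\<close> so close to 1/3 that the value there is negative.\<close>

lemma H_less_slope_neg:
  assumes "1/4 < r" "r < 1/3"
  shows "H_less_slope r < 0"
proof (rule ccontr)
  assume "\<not> H_less_slope r < 0"
  have "\<forall>\<^sub>F s in at_left (1/3). s \<in> {r<..<1/3::real}"
    using assms by (intro eventually_at_leftI) auto
  with eventually_H_less_slope_neg have "\<forall>\<^sub>F s in at_left (1/3). H_less_slope s < 0 \<and> s \<in> {r<..<1/3::real}"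
    by eventually_elim auto
  then obtain s where s: "r < s" "s < 1/3" "H_less_slope s < 0"
    using eventually_happens'[OF trivial_limit_at_left_real] by fastforce
  have "H_less_slope r \<le> (H_less_slope s - H_less_slope (1/4)) / (s - 1/4) * (r - 1/4) + H_less_slope (1/4)"
    by (rule convex_onD_Icc'[OF convex_on_subset[OF convex_on_H_less_slope]]) (use s assms in auto)
  also have "\<dots> < 0"
    unfolding H_less_slope_quarter using s assms by (simp add: mult_less_0_iff divide_less_0_iff)
  finally show False using \<open>\<not> _\<close> by simp
qed

text \<open>A nonpositive value at \<open>r\<close> and a negative one at some \<open>s\<close>
  beyond 1/4 would force, by convexity, a negative value at 1/4.\<close>

lemma H_less_slope_pos:
  assumes "0 < r" "r < 1/4"
  shows "0 < H_less_slope r"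
proof (rule ccontr)
  assume neg: "\<not> 0 < H_less_slope r"
  \<comment> \<open>The midpoint of 1/4 and 1/3.\<close>
  define s :: real where "s = 7/24"
  have s: "1/4 < s" "s < 1/3" by (simp_all add: s_def)
  have "H_less_slope (1/4) \<le> (H_less_slope r - H_less_slope s) / (s - r) * (s - 1/4) + H_less_slope s"
    by (rule convex_onD_Icc''[OF convex_on_subset[OF convex_on_H_less_slope]]) (use s assms in auto)
  also have "\<dots> = (H_less_slope r * (s - 1/4) + H_less_slope s * (1/4 - r)) / (s - r)"
    using s assms by (simp add: field_simps)
  also have "\<dots> < 0"
  proof -
    have "H_less_slope r * (s - 1/4) \<le> 0" using neg s by (simp add: mult_le_0_iff)
    moreover have "H_less_slope s * (1/4 - r) < 0"
      using H_less_slope_neg[OF s] assms by (simp add: mult_less_0_iff)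
    ultimately show ?thesis using s assms by (intro divide_neg_pos) auto
  qed
  finally show False by (simp add: H_less_slope_quarter)
qed

lemma H_less_less_quarter:
  assumes "0 < r" "r < 1/3" "r \<noteq> 1/4"
  shows "H_less r < H_less (1/4)"
proof -
  have cont: "continuous_on {a..b} (\<lambda>r. ln 2 * H_less r)" if "0 < a" "b < 1/3" for a b
    by (rule DERIV_continuous_on, rule has_field_derivative_at_within, 
        rule has_real_derivative_H_less) (use that in auto)
  have "ln 2 * H_less r < ln 2 * H_less (1/4)"
  proof (cases "r < 1/4")
    case True
    show ?thesis
    proof (rule DERIV_pos_imp_increasing_open[OF True])
      fix x assume "r < x" "x < 1/4"
      then show "\<exists>y. ((\<lambda>r. ln 2 * H_less r) has_real_derivative y) (at x) \<and> 0 < y"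
        using has_real_derivative_H_less[of x] H_less_slope_pos[of x] assms by fastforce
    qed (use assms in \<open>auto intro: cont\<close>)
  next
    case False
    then have "1/4 < r" using assms by auto
    then show ?thesis
    proof (rule DERIV_neg_imp_decreasing_open)
      fix x assume "1/4 < x" "x < r"
      then show "\<exists>y. ((\<lambda>r. ln 2 * H_less r) has_real_derivative y) (at x) \<and> y < 0"
        using has_real_derivative_H_less[of x] H_less_slope_neg[of x] assms by fastforce
    qed (use assms in \<open>auto intro: cont\<close>)
  qed
  then show ?thesis by simp
qed

section \<open>The value at 1/4 and the cross entropy bound on [1/3, 1/2]\<close>

lemma H_less_quarter: "H_less (1/4) = 4 - 3/4 * log 2 3"
proof -
  have "log 2 16 = (4::real)"
    using log_pow_cancel[of 2 4] by simp
  \<comment> \<open>At 1/4 four graphs have probability 1/16 and the other four 3/16.\<close>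
  then have "log 2 (1/16) = - (4::real)" "log 2 (3/16) = log 2 3 - (4::real)"
    by (simp_all add: log_divide)
  then show ?thesis by (simp add: H_less_def power2_eq_square field_simps)
qed

text \<open>Gibbs' inequality term by term, from \<open>ln x \<le> x - 1\<close>. The corrections
  \<open>(q - p) / ln 2\<close> cancel on summing over two distributions.\<close>

lemma cross_entropy_term:
  fixes p q :: real
  assumes "0 \<le> p" "0 < q"
  shows "- (p * log 2 p) \<le> - (p * log 2 q) + (q - p) / ln 2"
proof (cases "p = 0")
  case False
  then have "0 < p" using assms by simp
  have "p * ln (q / p) \<le> p * (q / p - 1)"
    using \<open>0 < p\<close> assms by (intro mult_left_mono ln_le_minus_one) auto
  also have "\<dots> = q - p" using \<open>0 < p\<close> by (simp add: field_simps)
  finally have "(p * ln q - p * ln p) / ln 2 \<le> (q - p) / ln 2"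
    using \<open>0 < p\<close> assms by (intro divide_right_mono) (simp_all add: ln_div algebra_simps)
  then show ?thesis by (simp add: log_def diff_divide_distrib)
qed (use assms in simp)

text \<open>The constant is the one at which \<open>5/3 * log 2 3\<close> equals
  \<open>4 - 3/4 * log 2 3\<close>; the bound itself is \<open>3 ^ 29 < 2 ^ 48\<close>.\<close>

lemma log2_three_less: "log 2 3 < (48/29 :: real)"
proof -
  have "log 2 (3 ^ 29) < log 2 (2 ^ 48 :: real)"
    by (subst log_less_cancel_iff) auto
  then have "29 * log 2 3 < (48 :: real)"
    by (simp add: log_nat_power del: power_numeral)
  then show ?thesis by simp
qed

lemma H_greater_less_quarter:
  assumes "1/3 \<le> r" "r \<le> 1/2"
  shows "H_greater r < H_less (1/4)"
proof -
  \<comment> \<open>The probabilities of the triangle, of each graph with two edges and of each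
    graph with one edge. The empty graph has probability zero in this range.\<close>
  define t p s where "t = 12 * r^2 - 6 * r + 1" "p = 6 * r - 1 - 8 * r^2" "s = (2 * r - 1)^2"
  have t: "1/3 \<le> t"
  proof -
    have "t - 1/3 = 12 * (r - 1/3) * (r - 1/6)"
      by (simp add: t_p_s_def power2_eq_square algebra_simps)
    moreover have "0 \<le> 12 * (r - 1/3) * (r - 1/6)" using assms by (intro mult_nonneg_nonneg) auto
    ultimately show ?thesis by simp
  qed
  have p: "0 \<le> p"
  proof -
    have "p = 8 * (r - 1/4) * (1/2 - r)"
      by (simp add: t_p_s_def power2_eq_square algebra_simps)
    then show ?thesis using assms by simp
  qed
  have s: "0 \<le> s" by (simp add: t_p_s_def)
  have sum: "t + 3 * p + 3 * s = 1"
    by (simp add: t_p_s_def power2_eq_square algebra_simps)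
  have log: "log 2 (1/3) = - log 2 (3 :: real)" "log 2 (1/9) = - 2 * log 2 (3 :: real)"
    using log_nat_power[of 3 2 2] by (simp_all add: log_divide)
  have "H_greater r = - (t * log 2 t) + 3 * - (p * log 2 p) + 3 * - (s * log 2 s)"
    by (simp add: H_greater_def t_p_s_def)
  \<comment> \<open>The reference weights 1/3 and 1/9 are the values of \<open>t\<close>,
    \<open>p\<close> and \<open>s\<close> at \<open>r = 1/3\<close>.\<close>
  also have "\<dots> \<le> (- (t * log 2 (1/3)) + (1/3 - t) / ln 2) + 3 * (- (p * log 2 (1/9)) + (1/9 - p) / ln 2)
      + 3 * (- (s * log 2 (1/9)) + (1/9 - s) / ln 2)"
    using t p s by (intro add_mono mult_left_mono cross_entropy_term) auto
  also have "\<dots> = (t + 6 * p + 6 * s) * log 2 3 + (1 - (t + 3 * p + 3 * s)) / ln 2"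
    unfolding log by (simp add: field_simps)
  also have "\<dots> = (2 - t) * log 2 3"
  proof -
    have "t + 6 * p + 6 * s = 2 - t" using sum by linarith
    then show ?thesis unfolding sum by simp
  qed
  also have "\<dots> \<le> 5/3 * log 2 3" using t by (intro mult_right_mono) auto
  also have "\<dots> < 4 - 3/4 * log 2 3" using log2_three_less by simp
  finally show ?thesis by (simp add: H_less_quarter)
qed

section \<open>Three uniform points on the circle\<close>

text \<open>The distance to the nearest integer. Unlike the formula in \<open>torus_dist\<close> it
  is periodic on the whole line, so points may be translated without reducing them to
  [0, 1].\<close>

definition circle_norm :: "real \<Rightarrow> real" where
  "circle_norm t = min (frac t) (1 - frac t)"

lemma circle_norm_add_int [simp]: "circle_norm (t + of_int n) = circle_norm t"
  by (simp add: circle_norm_def frac_def)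

lemma circle_norm_diff_int [simp]: "circle_norm (t - of_int n) = circle_norm t"
  by (simp add: circle_norm_def frac_def)

lemma circle_norm_minus [simp]: "circle_norm (- t) = circle_norm t"
  by (auto simp: circle_norm_def frac_neg min_def dest: frac_eq_0_iff[THEN iffD2])

lemma circle_norm_eq_min: "circle_norm t = min \<bar>t\<bar> (1 - \<bar>t\<bar>)" if "\<bar>t\<bar> \<le> 1"
proof -
  \<comment> \<open>At \<open>s = 1\<close> the fractional part drops to 0, but both sides are 0
    there.\<close>
  have *: "circle_norm s = min s (1 - s)" if "0 \<le> s" "s \<le> 1" for s
    using that frac_eq[of s] by (cases "s = 1") (auto simp: circle_norm_def)
  show ?thesis
    using *[of t] *[of "- t"] that by (cases "0 \<le> t") auto
qed

lemma circle_norm_eq_abs: "circle_norm t = \<bar>t\<bar>" if "\<bar>t\<bar> \<le> 1/2"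
  using that by (subst circle_norm_eq_min) (auto simp: min_def)

lemma torus_dist_eq_circle_norm:
  "torus_dist x y = circle_norm (x - y)" if "x \<in> {0..1}" "y \<in> {0..1}"
  using that by (subst circle_norm_eq_min) (auto simp: torus_dist_def)

lemma measurable_circle_norm [measurable]: "circle_norm \<in> borel_measurable borel"
  unfolding circle_norm_def [abs_def] frac_def by measurable

text \<open>Only the fractional part \<open>f\<close> of the shift matters. The shifted period
  [f, f + 1] is cut at 1 and the piece beyond 1 is moved back by one unit; single points are null
  sets.\<close>

lemma nn_integral_periodic:
  fixes F :: "real \<Rightarrow> ennreal" and a :: real
  assumes [measurable]: "F \<in> borel_measurable borel"
    and per: "\<And>y n. F (y + of_int n) = F y"
  shows "(\<integral>\<^sup>+y. F y * indicator {0..1} y \<partial>lborel) = (\<integral>\<^sup>+y. F (a + y) * indicator {0..1} y \<partial>lborel)"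
proof -
  define f where "f = frac a"
  have f: "0 \<le> f" "f < 1" by (auto simp: f_def frac_lt_1)
  have shift: "F (a + y) = F (f + y)" for y
    using per[of "f + y" "\<lfloor>a\<rfloor>"] by (simp add: f_def frac_def algebra_simps)
  have "(\<integral>\<^sup>+y. F (a + y) * indicator {0..1} y \<partial>lborel) = (\<integral>\<^sup>+y. F y * indicator {f..f+1} y \<partial>lborel)"
    unfolding shift
    by (subst (2) nn_integral_real_affine[where c = 1 and t = f])
      (auto intro!: nn_integral_cong split: split_indicator)
  also have "\<dots> = (\<integral>\<^sup>+y. F y * indicator {f..<1} y + F y * indicator {1..<1+f} y \<partial>lborel)"
    using AE_lborel_singleton[of "f + 1"] f
    by (intro nn_integral_cong_AE) (auto elim!: eventually_mono split: split_indicator)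
  also have "\<dots> = (\<integral>\<^sup>+y. F y * indicator {f..<1} y \<partial>lborel) + (\<integral>\<^sup>+y. F y * indicator {1..<1+f} y \<partial>lborel)"
    by (intro nn_integral_add) auto
  also have "(\<integral>\<^sup>+y. F y * indicator {1..<1+f} y \<partial>lborel) = (\<integral>\<^sup>+y. F y * indicator {0..<f} y \<partial>lborel)"
    using per[of _ 1]
    by (subst nn_integral_real_affine[where c = 1 and t = 1])
      (auto intro!: nn_integral_cong simp: add.commute split: split_indicator)
  also have "(\<integral>\<^sup>+y. F y * indicator {f..<1} y \<partial>lborel) + (\<integral>\<^sup>+y. F y * indicator {0..<f} y \<partial>lborel)
      = (\<integral>\<^sup>+y. F y * indicator {f..<1} y + F y * indicator {0..<f} y \<partial>lborel)"
    by (intro nn_integral_add[symmetric]) auto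
  also have "\<dots> = (\<integral>\<^sup>+y. F y * indicator {0..1} y \<partial>lborel)"
    using AE_lborel_singleton[of 1] f
    by (intro nn_integral_cong_AE) (auto elim!: eventually_mono split: split_indicator)
  finally show ?thesis ..
qed

text \<open>Recentring at \<open>x\<close>: the displacement from any fixed point to a uniform point
  is uniform on [-1/2, 1/2].\<close>

lemma nn_integral_uniform_torus:
  fixes F :: "real \<Rightarrow> ennreal"
  assumes [measurable]: "F \<in> borel_measurable borel"
    and per: "\<And>y n. F (y + of_int n) = F y"
  shows "(\<integral>\<^sup>+y. F y \<partial>uniform_measure lborel {0..1}) =
    (\<integral>\<^sup>+v. F (x + v) * indicator {-1/2..1/2} v \<partial>lborel)"
proof -
  have "(\<integral>\<^sup>+y. F y \<partial>uniform_measure lborel {0..1}) = (\<integral>\<^sup>+y. F y * indicator {0..1} y \<partial>lborel)"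
    by (simp add: nn_integral_uniform_measure divide_ennreal_def)
  also have "\<dots> = (\<integral>\<^sup>+y. F ((x - 1/2) + y) * indicator {0..1} y \<partial>lborel)"
    by (rule nn_integral_periodic) fact+
  also have "\<dots> = (\<integral>\<^sup>+v. F (x + v) * indicator {-1/2..1/2} v \<partial>lborel)"
    by (subst (2) nn_integral_real_affine[where c = 1 and t = "- 1/2"])
      (auto intro!: nn_integral_cong split: split_indicator simp: algebra_simps)
  finally show ?thesis .
qed

lemma nn_integral_PiM_triple:
  fixes f :: "'b \<times> 'b \<times> 'b \<Rightarrow> ennreal"
  assumes N: "sigma_finite_measure N" and ijk: "i \<noteq> j" "i \<noteq> k" "j \<noteq> k"
    and [measurable]: "f \<in> borel_measurable (N \<Otimes>\<^sub>M N \<Otimes>\<^sub>M N)"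
  shows "(\<integral>\<^sup>+h. f (h i, h j, h k) \<partial>PiM {i, j, k} (\<lambda>_. N)) =
    (\<integral>\<^sup>+x. \<integral>\<^sup>+y. \<integral>\<^sup>+z. f (x, y, z) \<partial>N \<partial>N \<partial>N)"
proof -
  interpret N: sigma_finite_measure N by fact
  interpret product_sigma_finite "\<lambda>_. N" by standard
  have [measurable]: "(\<lambda>h. h a) \<in> measurable (PiM I (\<lambda>_. N)) N" if "a \<in> I" for a I
    using that by simp
  have "(\<integral>\<^sup>+h. f (h i, h j, h k) \<partial>PiM {i, j, k} (\<lambda>_. N)) =
      (\<integral>\<^sup>+x. \<integral>\<^sup>+h. f (x, h j, h k) \<partial>PiM {j, k} (\<lambda>_. N) \<partial>N)"
    using ijk by (subst product_nn_integral_insert_rev) auto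
  also have "\<dots> = (\<integral>\<^sup>+x. \<integral>\<^sup>+y. \<integral>\<^sup>+h. f (x, y, h k) \<partial>PiM {k} (\<lambda>_. N) \<partial>N \<partial>N)"
    using ijk by (intro nn_integral_cong, subst product_nn_integral_insert_rev) auto
  also have "\<dots> = (\<integral>\<^sup>+x. \<integral>\<^sup>+y. \<integral>\<^sup>+z. f (x, y, z) \<partial>N \<partial>N \<partial>N)"
    by (intro nn_integral_cong product_nn_integral_singleton) auto
  finally show ?thesis .
qed

section \<open>Reduction of three uniform points to two displacements\<close>

locale uniform_torus_points = prob_space M for M :: "'a measure" +
  fixes X :: "nat \<Rightarrow> 'a \<Rightarrow> real" and I :: "nat set"
  assumes indep: "indep_vars (\<lambda>_. borel) X I"
    and uniform: "i \<in> I \<Longrightarrow> distr M borel (X i) = uniform_measure lborel {0..1}"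
begin

lemma random_variable_X: "i \<in> I \<Longrightarrow> random_variable borel (X i)"
  using indep by (simp add: indep_vars_def)

text \<open>The law confines the points to [0, 1] only almost surely, so \<open>circle_norm\<close>
  replaces \<open>torus_dist\<close> up to a null set.\<close>

lemma AE_X_unit: "AE \<omega> in M. X i \<omega> \<in> {0..1}" if i: "i \<in> I"
proof -
  have "AE x in uniform_measure lborel {0..1::real}. x \<in> {0..1}"
    by (rule AE_uniform_measureI) auto
  then have "AE x in distr M borel (X i). x \<in> {0..1}"
    unfolding uniform[OF i] .
  then show ?thesis
    by (subst (asm) AE_distr_iff) (use random_variable_X[OF i] in auto)
qed

lemma distr_triple:
  assumes "i \<in> I" "j \<in> I" "k \<in> I"
  shows "distr M (PiM {i, j, k} (\<lambda>_. borel)) (\<lambda>\<omega>. \<lambda>l\<in>{i, j, k}. X l \<omega>) =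
    PiM {i, j, k} (\<lambda>_. uniform_measure lborel {0..1})"
proof -
  have "indep_vars (\<lambda>_. borel) X {i, j, k}"
    using indep_vars_subset[OF indep] assms by auto
  then have "distr M (PiM {i, j, k} (\<lambda>_. borel)) (\<lambda>\<omega>. \<lambda>l\<in>{i, j, k}. X l \<omega>) =
      PiM {i, j, k} (\<lambda>l. distr M borel (X l))"
    by (subst (asm) indep_vars_iff_distr_eq_PiM') (use assms random_variable_X in auto)
  also have "\<dots> = PiM {i, j, k} (\<lambda>_. uniform_measure lborel {0..1})"
    using assms uniform by (intro PiM_cong) auto
  finally show ?thesis .
qed

text \<open>With the points written as \<open>x\<close>, \<open>x + v\<close> and
  \<open>x + w\<close>, periodicity removes \<open>x\<close> from the inner integrals, and
  integrating over \<open>x\<close> contributes the factor 1. The third distance stays a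
  \<open>circle_norm\<close> because \<open>\<bar>v - w\<bar>\<close> may exceed 1/2.\<close>

lemma emeasure_triple:
  assumes I: "i \<in> I" "j \<in> I" "k \<in> I" and ijk: "i \<noteq> j" "i \<noteq> k" "j \<noteq> k"
    and [measurable]: "Measurable.pred (borel \<Otimes>\<^sub>M borel \<Otimes>\<^sub>M borel) P"
  shows "emeasure M {\<omega> \<in> space M. P (torus_dist (X i \<omega>) (X j \<omega>), torus_dist (X i \<omega>) (X k \<omega>),
      torus_dist (X j \<omega>) (X k \<omega>))} =
    (\<integral>\<^sup>+v. emeasure lborel {w \<in> {-1/2..1/2}. P (\<bar>v\<bar>, \<bar>w\<bar>, circle_norm (v - w))}
      * indicator {-1/2..1/2} v \<partial>lborel)"
proof -
  define U where "U = uniform_measure lborel {0..1::real}"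
  have U_sets [measurable_cong]: "sets U = sets borel" by (simp add: U_def)
  interpret U: prob_space U unfolding U_def by (rule prob_space_uniform_measure) auto
  note [measurable] = random_variable_X[OF I(1)] random_variable_X[OF I(2)] random_variable_X[OF I(3)]
  have [measurable]: "(\<lambda>h. h a) \<in> measurable (PiM {i, j, k} (\<lambda>_. borel)) borel" if "a \<in> {i,j,k}" for a
    using that by simp
  have [measurable]: "(\<lambda>(x, y). torus_dist x y) \<in> borel_measurable (borel \<Otimes>\<^sub>M borel)"
    unfolding torus_dist_def case_prod_beta by measurable
  let ?Q = "\<lambda>(x, y, z). P (circle_norm (x - y), circle_norm (x - z), circle_norm (y - z))"
  let ?f = "\<lambda>p. indicator {p. ?Q p} p :: ennreal"
  have [measurable]: "Measurable.pred (borel \<Otimes>\<^sub>M borel \<Otimes>\<^sub>M borel) ?Q"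
    unfolding case_prod_beta by measurable
  have [measurable]: "?f \<in> borel_measurable (borel \<Otimes>\<^sub>M borel \<Otimes>\<^sub>M borel)"
    by measurable
  have "emeasure M {\<omega> \<in> space M. P (torus_dist (X i \<omega>) (X j \<omega>), torus_dist (X i \<omega>) (X k \<omega>),
      torus_dist (X j \<omega>) (X k \<omega>))} = emeasure M {\<omega> \<in> space M. ?Q (X i \<omega>, X j \<omega>, X k \<omega>)}"
  proof (rule emeasure_eq_AE)
    show "AE \<omega> in M. (\<omega> \<in> {\<omega> \<in> space M. P (torus_dist (X i \<omega>) (X j \<omega>), torus_dist (X i \<omega>) (X k \<omega>),
      torus_dist (X j \<omega>) (X k \<omega>))}) = (\<omega> \<in> {\<omega> \<in> space M. ?Q (X i \<omega>, X j \<omega>, X k \<omega>)})"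
      using AE_X_unit[OF I(1)] AE_X_unit[OF I(2)] AE_X_unit[OF I(3)]
      by eventually_elim (simp add: torus_dist_eq_circle_norm)
  qed measurable
  also have "\<dots> = (\<integral>\<^sup>+\<omega>. indicator {\<omega> \<in> space M. ?Q (X i \<omega>, X j \<omega>, X k \<omega>)} \<omega> \<partial>M)"
    by (rule nn_integral_indicator[symmetric]) measurable
  also have "\<dots> = (\<integral>\<^sup>+\<omega>. ?f (X i \<omega>, X j \<omega>, X k \<omega>) \<partial>M)"
    by (intro nn_integral_cong) (auto split: split_indicator)
  also have "\<dots> = (\<integral>\<^sup>+h. ?f (h i, h j, h k)
      \<partial>distr M (PiM {i, j, k} (\<lambda>_. borel)) (\<lambda>\<omega>. \<lambda>l\<in>{i, j, k}. X l \<omega>))"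
    by (subst nn_integral_distr) (auto intro!: measurable_restrict)
  also have "\<dots> = (\<integral>\<^sup>+h. ?f (h i, h j, h k) \<partial>PiM {i, j, k} (\<lambda>_. U))"
    unfolding U_def distr_triple[OF I] ..
  also have "\<dots> = (\<integral>\<^sup>+x. \<integral>\<^sup>+y. \<integral>\<^sup>+z. ?f (x, y, z) \<partial>U \<partial>U \<partial>U)"
    by (rule nn_integral_PiM_triple) (auto simp: ijk U.sigma_finite_measure_axioms)
  also have "\<dots> = (\<integral>\<^sup>+x. (\<integral>\<^sup>+v. emeasure lborel {w \<in> {-1/2..1/2}. P (\<bar>v\<bar>, \<bar>w\<bar>, circle_norm (v - w))}
      * indicator {-1/2..1/2} v \<partial>lborel) \<partial>U)"
  proof (rule nn_integral_cong)
    fix x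
    \<comment> \<open>The innermost integral after recentring \<open>z = x + w\<close>. It is again
      periodic in \<open>y\<close>, so \<open>y\<close> can be recentred in the same way.\<close>
    define G where "G y = (\<integral>\<^sup>+w. indicator {w \<in> {-1/2..1/2}. P (circle_norm (x - y), \<bar>w\<bar>, circle_norm (y - x - w))} w \<partial>lborel :: ennreal)" for y
    have [measurable]: "G \<in> borel_measurable borel"
      unfolding G_def [abs_def] by measurable
    have "(\<integral>\<^sup>+z. ?f (x, y, z) \<partial>U) = G y" for y
    proof -
      have "(\<integral>\<^sup>+z. ?f (x, y, z) \<partial>U) = (\<integral>\<^sup>+w. ?f (x, y, x + w) * indicator {-1/2..1/2} w \<partial>lborel)"
        unfolding U_def
        by (rule nn_integral_uniform_torus) (auto simp: diff_diff_eq[symmetric] indicator_def)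
      also have "\<dots> = G y"
        unfolding G_def by (intro nn_integral_cong)
          (auto simp: circle_norm_eq_abs diff_diff_eq split: split_indicator)
      finally show ?thesis .
    qed
    then have "(\<integral>\<^sup>+y. \<integral>\<^sup>+z. ?f (x, y, z) \<partial>U \<partial>U) = (\<integral>\<^sup>+y. G y \<partial>U)" by simp
    also have "\<dots> = (\<integral>\<^sup>+v. G (x + v) * indicator {-1/2..1/2} v \<partial>lborel)"
      unfolding U_def
    proof (rule nn_integral_uniform_torus)
      fix y n
      have "circle_norm (x - (y + of_int n)) = circle_norm (x - y)"
        by (simp add: diff_diff_eq[symmetric])
      moreover have "circle_norm (y + of_int n - x - w) = circle_norm (y - x - w)" for w
        using circle_norm_add_int[of "y - x - w" n] by (simp add: algebra_simps)
      ultimately show "G (y + of_int n) = G y" by (simp add: G_def)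
    qed measurable
    also have "\<dots> = (\<integral>\<^sup>+v. emeasure lborel {w \<in> {-1/2..1/2}. P (\<bar>v\<bar>, \<bar>w\<bar>, circle_norm (v - w))}
      * indicator {-1/2..1/2} v \<partial>lborel)"
    proof (rule nn_integral_cong)
      fix v :: real
      have "{w \<in> {-1/2..1/2}. P (\<bar>v\<bar>, \<bar>w\<bar>, circle_norm (v - w))} \<in> sets borel" by measurable
      then show "G (x + v) * indicator {-1/2..1/2} v =
          emeasure lborel {w \<in> {-1/2..1/2}. P (\<bar>v\<bar>, \<bar>w\<bar>, circle_norm (v - w))} * indicator {-1/2..1/2} v"
        by (auto simp: G_def circle_norm_eq_abs split: split_indicator)
    qed
    finally show "(\<integral>\<^sup>+y. \<integral>\<^sup>+z. ?f (x, y, z) \<partial>U \<partial>U) = \<dots>" .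
  qed
  also have "\<dots> = (\<integral>\<^sup>+v. emeasure lborel {w \<in> {-1/2..1/2}. P (\<bar>v\<bar>, \<bar>w\<bar>, circle_norm (v - w))}
      * indicator {-1/2..1/2} v \<partial>lborel)"
    by (simp add: U.emeasure_space_1)
  finally show ?thesis .
qed

end

text \<open>Keeps the vertex label \<open>1\<close> from being rewritten to
  \<open>Suc 0\<close>.\<close>

declare One_nat_def [simp del]

text \<open>Two arcs of radius \<open>r\<close> around 0 and \<open>v\<close> always overlap on the
  near side, and also around the far side of the circle once \<open>\<bar>v\<bar>\<close> exceeds
  \<open>1 - 2 * r\<close>. Since \<open>ennreal\<close> sends negative numbers to 0, the second
  summand vanishes before that.\<close>

lemma emeasure_common_neighbours:
  assumes r: "r < 1/2" and v: "\<bar>v\<bar> \<le> r"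
  shows "emeasure lborel {w \<in> {-1/2..1/2}. \<bar>w\<bar> \<le> r \<and> circle_norm (v - w) \<le> r} =
    ennreal (2 * r - \<bar>v\<bar>) + ennreal (\<bar>v\<bar> - (1 - 2 * r))"
proof -
  have *: "emeasure lborel ({a..b} \<union> {c..d}) = ennreal (b - a) + ennreal (d - c)"
    if "{a..b} \<inter> {c..d} = {}" for a b c d :: real
    using that by (subst plus_emeasure[symmetric]) (auto simp: emeasure_lborel_Icc_eq ennreal_neg)
  \<comment> \<open>Here \<open>\<bar>v - w\<bar> \<le> 2 * r < 1\<close>, so
    \<open>circle_norm_eq_min\<close> applies.\<close>
  have norm: "circle_norm (v - w) \<le> r \<longleftrightarrow> \<bar>v - w\<bar> \<le> r \<or> 1 - r \<le> \<bar>v - w\<bar>" if "\<bar>w\<bar> \<le> r" for w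
    using that v r by (subst circle_norm_eq_min) auto
  show ?thesis
  proof (cases "0 \<le> v")
    case True
    have "circle_norm (v - w) \<le> r \<longleftrightarrow> v - r \<le> w \<or> w \<le> v - (1 - r)" if "\<bar>w\<bar> \<le> r" for w
      using norm[OF that] that True v r by linarith
    then have "{w \<in> {-1/2..1/2}. \<bar>w\<bar> \<le> r \<and> circle_norm (v - w) \<le> r} = {v - r..r} \<union> {- r..v - (1 - r)}"
      using True v r by auto
    then show ?thesis using True v r by (auto simp: * algebra_simps)
  next
    case False
    have "circle_norm (v - w) \<le> r \<longleftrightarrow> w \<le> v + r \<or> v + (1 - r) \<le> w" if "\<bar>w\<bar> \<le> r" for w
      using norm[OF that] that False v r by linarith
    then have "{w \<in> {-1/2..1/2}. \<bar>w\<bar> \<le> r \<and> circle_norm (v - w) \<le> r} = {- r..v + r} \<union> {v + (1 - r)..r}"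
      using False v r by auto
    then show ?thesis using False v r by (auto simp: * algebra_simps)
  qed
qed

lemma nn_integral_abs_symmetric:
  fixes F :: "real \<Rightarrow> ennreal"
  assumes [measurable]: "F \<in> borel_measurable borel"
  shows "(\<integral>\<^sup>+v. F \<bar>v\<bar> * indicator {-r..r} v \<partial>lborel) = 2 * (\<integral>\<^sup>+v. F v * indicator {0..r} v \<partial>lborel)"
proof -
  have "(\<integral>\<^sup>+v. F \<bar>v\<bar> * indicator {-r..r} v \<partial>lborel) =
      (\<integral>\<^sup>+v. F v * indicator {0..r} v + F (- v) * indicator {0..r} (- v) \<partial>lborel)"
    using AE_lborel_singleton[of 0]
    by (intro nn_integral_cong_AE) (auto elim!: eventually_mono split: split_indicator)
  also have "\<dots> = (\<integral>\<^sup>+v. F v * indicator {0..r} v \<partial>lborel) + (\<integral>\<^sup>+v. F (- v) * indicator {0..r} (- v) \<partial>lborel)"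
    by (rule nn_integral_add) measurable
  also have "(\<integral>\<^sup>+v. F (- v) * indicator {0..r} (- v) \<partial>lborel) = (\<integral>\<^sup>+v. F v * indicator {0..r} v \<partial>lborel)"
    by (subst (2) nn_integral_real_affine[where c = "- 1" and t = 0]) simp_all
  finally show ?thesis by (simp add: mult_2)
qed

text \<open>The far overlap starts at \<open>1 - 2 * r\<close>, which is below \<open>r\<close>
  exactly when \<open>r > 1/3\<close>. This is the origin of the two regimes of the entropy.\<close>

lemma nn_integral_common_neighbours:
  fixes r :: real
  assumes "0 \<le> r" "r < 1/2"
  shows "(\<integral>\<^sup>+v. (ennreal (2 * r - \<bar>v\<bar>) + ennreal (\<bar>v\<bar> - (1 - 2 * r))) * indicator {-r..r} v \<partial>lborel) =
    ennreal (3 * r^2 + (max 0 (3 * r - 1))^2)"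
proof -
  have 1: "(\<integral>\<^sup>+v. ennreal (2 * r - v) * indicator {0..r} v \<partial>lborel) = ennreal (3/2 * r^2)"
  proof -
    have "(\<integral>\<^sup>+v. ennreal (2 * r - v) * indicator {0..r} v \<partial>lborel) =
        ennreal ((2 * r * r - r^2 / 2) - (2 * r * 0 - 0^2 / 2))"
      using assms by (intro nn_integral_FTC_Icc) (auto intro!: derivative_eq_intros)
    then show ?thesis by (simp add: power2_eq_square)
  qed
  have 2: "(\<integral>\<^sup>+v. ennreal (v - (1 - 2 * r)) * indicator {0..r} v \<partial>lborel) = ennreal ((max 0 (3 * r - 1))^2 / 2)"
  proof -
    have "(\<integral>\<^sup>+v. ennreal (v - (1 - 2 * r)) * indicator {0..r} v \<partial>lborel) =
        (\<integral>\<^sup>+v. ennreal (v - (1 - 2 * r)) * indicator {1 - 2 * r..r} v \<partial>lborel)"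
      using assms by (intro nn_integral_cong) (auto split: split_indicator simp: ennreal_neg)
    also have "\<dots> = ennreal ((max 0 (3 * r - 1))^2 / 2)"
    proof (cases "1 - 2 * r \<le> r")
      case True
      then have "(\<integral>\<^sup>+v. ennreal (v - (1 - 2 * r)) * indicator {1 - 2 * r..r} v \<partial>lborel) =
          ennreal ((r - (1 - 2 * r))^2 / 2 - ((1 - 2 * r) - (1 - 2 * r))^2 / 2)"
        by (intro nn_integral_FTC_Icc) (auto intro!: derivative_eq_intros)
      then show ?thesis using True by (simp add: max_def)
    qed (simp add: max_def)
    finally show ?thesis .
  qed
  have "(\<integral>\<^sup>+v. (ennreal (2 * r - \<bar>v\<bar>) + ennreal (\<bar>v\<bar> - (1 - 2 * r))) * indicator {-r..r} v \<partial>lborel) =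
      2 * (\<integral>\<^sup>+v. (ennreal (2 * r - v) + ennreal (v - (1 - 2 * r))) * indicator {0..r} v \<partial>lborel)"
    by (rule nn_integral_abs_symmetric[where F = "\<lambda>t. ennreal (2 * r - t) + ennreal (t - (1 - 2 * r))"]) measurable
  also have "(\<integral>\<^sup>+v. (ennreal (2 * r - v) + ennreal (v - (1 - 2 * r))) * indicator {0..r} v \<partial>lborel) =
      ennreal (3/2 * r^2) + ennreal ((max 0 (3 * r - 1))^2 / 2)"
    unfolding 1[symmetric] 2[symmetric] distrib_right by (rule nn_integral_add) measurable
  also have "2 * \<dots> = ennreal 2 * ennreal (3/2 * r^2 + (max 0 (3 * r - 1))^2 / 2)"
    by (subst ennreal_plus) auto
  also have "\<dots> = ennreal (3 * r^2 + (max 0 (3 * r - 1))^2)"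
    by (subst ennreal_mult[symmetric]) auto
  finally show ?thesis .
qed

section \<open>Probabilities of one edge, two edges and a triangle\<close>

context uniform_torus_points
begin

abbreviation near :: "real \<Rightarrow> nat \<Rightarrow> nat \<Rightarrow> 'a set" where
  "near r i j \<equiv> {\<omega> \<in> space M. torus_dist (X i \<omega>) (X j \<omega>) \<le> r}"

lemma near_measurable:
  assumes "i \<in> I" "j \<in> I"
  shows "near r i j \<in> events"
proof -
  note [measurable] = random_variable_X[OF assms(1)] random_variable_X[OF assms(2)]
  show ?thesis unfolding torus_dist_def by measurable
qed

lemma prob_near:
  assumes "i \<in> I" "j \<in> I" "k \<in> I" "i \<noteq> j" "i \<noteq> k" "j \<noteq> k" "0 \<le> r" "r < 1/2"
  shows "prob (near r i j) = 2 * r"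
proof -
  have "emeasure M (near r i j) =
    (\<integral>\<^sup>+v. emeasure lborel {w \<in> {-1/2..1/2::real}. \<bar>v\<bar> \<le> r} * indicator {-1/2..1/2} v \<partial>lborel)"
    using emeasure_triple[of i j k "\<lambda>(a, b, c). a \<le> r"] assms by (simp add: case_prod_beta)
  also have "\<dots> = (\<integral>\<^sup>+v. indicator {-r..r} v \<partial>lborel)"
  proof (rule nn_integral_cong)
    fix v :: real
    have "{w \<in> {-1/2..1/2::real}. \<bar>v\<bar> \<le> r} = (if \<bar>v\<bar> \<le> r then {-1/2..1/2} else {})"
      by auto
    then show "emeasure lborel {w \<in> {-1/2..1/2::real}. \<bar>v\<bar> \<le> r} * indicator {-1/2..1/2} v = indicator {-r..r} v"
      using assms by (auto split: split_indicator)
  qed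
  also have "\<dots> = ennreal (2 * r)" using assms by simp
  finally show ?thesis using assms by (simp add: emeasure_eq_measure)
qed

lemma prob_near_near:
  assumes "i \<in> I" "j \<in> I" "k \<in> I" "i \<noteq> j" "i \<noteq> k" "j \<noteq> k" "0 \<le> r" "r < 1/2"
  shows "prob (near r i j \<inter> near r i k) = 4 * r^2"
proof -
  have "near r i j \<inter> near r i k =
    {\<omega> \<in> space M. torus_dist (X i \<omega>) (X j \<omega>) \<le> r \<and> torus_dist (X i \<omega>) (X k \<omega>) \<le> r}"
    by auto
  then have "emeasure M (near r i j \<inter> near r i k) =
    (\<integral>\<^sup>+v. emeasure lborel {w \<in> {-1/2..1/2}. \<bar>v\<bar> \<le> r \<and> \<bar>w\<bar> \<le> r} * indicator {-1/2..1/2} v \<partial>lborel)"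
    using emeasure_triple[of i j k "\<lambda>(a, b, c). a \<le> r \<and> b \<le> r"] assms by (simp add: case_prod_beta)
  also have "\<dots> = (\<integral>\<^sup>+v. ennreal (2 * r) * indicator {-r..r} v \<partial>lborel)"
  proof (rule nn_integral_cong)
    fix v :: real
    have "{w \<in> {-1/2..1/2}. \<bar>v\<bar> \<le> r \<and> \<bar>w\<bar> \<le> r} = (if \<bar>v\<bar> \<le> r then {-r..r} else {})"
      using assms by auto
    then show "emeasure lborel {w \<in> {-1/2..1/2}. \<bar>v\<bar> \<le> r \<and> \<bar>w\<bar> \<le> r} * indicator {-1/2..1/2} v =
        ennreal (2 * r) * indicator {-r..r} v"
      using assms by (auto split: split_indicator)
  qed
  also have "\<dots> = ennreal (4 * r^2)"
    using assms by (simp add: nn_integral_cmult ennreal_mult[symmetric] power2_eq_square)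
  finally show ?thesis using assms by (simp add: emeasure_eq_measure)
qed

lemma prob_triangle:
  assumes "i \<in> I" "j \<in> I" "k \<in> I" "i \<noteq> j" "i \<noteq> k" "j \<noteq> k" "0 \<le> r" "r < 1/2"
  shows "prob (near r i j \<inter> near r i k \<inter> near r j k) = 3 * r^2 + (max 0 (3 * r - 1))^2"
proof -
  have "near r i j \<inter> near r i k \<inter> near r j k =
    {\<omega> \<in> space M. torus_dist (X i \<omega>) (X j \<omega>) \<le> r \<and> torus_dist (X i \<omega>) (X k \<omega>) \<le> r
      \<and> torus_dist (X j \<omega>) (X k \<omega>) \<le> r}"
    by auto
  then have "emeasure M (near r i j \<inter> near r i k \<inter> near r j k) =
    (\<integral>\<^sup>+v. emeasure lborel {w \<in> {-1/2..1/2}. \<bar>v\<bar> \<le> r \<and> \<bar>w\<bar> \<le> r \<and> circle_norm (v - w) \<le> r}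
      * indicator {-1/2..1/2} v \<partial>lborel)"
    using emeasure_triple[of i j k "\<lambda>(a, b, c). a \<le> r \<and> b \<le> r \<and> c \<le> r"] assms by (simp add: case_prod_beta)
  also have "\<dots> =
    (\<integral>\<^sup>+v. (ennreal (2 * r - \<bar>v\<bar>) + ennreal (\<bar>v\<bar> - (1 - 2 * r))) * indicator {-r..r} v \<partial>lborel)"
  proof (rule nn_integral_cong)
    fix v :: real
    show "emeasure lborel {w \<in> {-1/2..1/2}. \<bar>v\<bar> \<le> r \<and> \<bar>w\<bar> \<le> r \<and> circle_norm (v - w) \<le> r}
        * indicator {-1/2..1/2} v =
      (ennreal (2 * r - \<bar>v\<bar>) + ennreal (\<bar>v\<bar> - (1 - 2 * r))) * indicator {-r..r} v"
    proof (cases "\<bar>v\<bar> \<le> r")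
      case True
      then show ?thesis
        using assms emeasure_common_neighbours[of r v] by (simp add: indicator_def abs_le_iff)
    next
      case False
      then show ?thesis by (auto split: split_indicator)
    qed
  qed
  also have "\<dots> = ennreal (3 * r^2 + (max 0 (3 * r - 1))^2)"
    using assms by (intro nn_integral_common_neighbours)
  finally show ?thesis by (simp add: emeasure_eq_measure del: ennreal_plus)
qed

end

section \<open>The graph distribution and its entropy\<close>

lemma (in prob_space) prob_inclusion_exclusion_three:
  assumes [measurable]: "A \<in> events" "B \<in> events" "C \<in> events"
  shows "prob (A \<inter> B - C) = prob (A \<inter> B) - prob (A \<inter> B \<inter> C)"
    and "prob (A - B - C) = prob A - prob (A \<inter> B) - prob (A \<inter> C) + prob (A \<inter> B \<inter> C)"
    and "prob (space M - A - B - C) = 1 - prob A - prob B - prob C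
      + prob (A \<inter> B) + prob (A \<inter> C) + prob (B \<inter> C) - prob (A \<inter> B \<inter> C)"
proof -
  \<comment> \<open>Stated for arbitrary events because it is applied below with
    \<open>space M\<close> in place of \<open>A\<close> as well.\<close>
  have two: "prob (A - B - C) = prob A - prob (A \<inter> B) - prob (A \<inter> C) + prob (A \<inter> B \<inter> C)"
    if [measurable]: "A \<in> events" "B \<in> events" "C \<in> events" for A B C
  proof -
    have "prob (A - B - C) = prob (A - B) - prob ((A - B) \<inter> C)"
      by (rule finite_measure_Diff') auto
    also have "(A - B) \<inter> C = (A \<inter> C) - B" by auto
    also have "prob (A - B) = prob A - prob (A \<inter> B)"
      by (rule finite_measure_Diff') auto
    also have "prob (A \<inter> C - B) = prob (A \<inter> C) - prob (A \<inter> C \<inter> B)"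
      by (rule finite_measure_Diff') auto
    also have "A \<inter> C \<inter> B = A \<inter> B \<inter> C" by auto
    finally show ?thesis by simp
  qed
  show "prob (A \<inter> B - C) = prob (A \<inter> B) - prob (A \<inter> B \<inter> C)"
    by (rule finite_measure_Diff') auto
  show "prob (A - B - C) = prob A - prob (A \<inter> B) - prob (A \<inter> C) + prob (A \<inter> B \<inter> C)"
    by (rule two) auto
  have "prob (space M - A - B - C) = prob (space M - B - C) - prob ((space M - B - C) \<inter> A)"
    by (subst finite_measure_Diff'[symmetric]) (auto intro!: arg_cong[where f = prob])
  also have "(space M - B - C) \<inter> A = A - B - C"
    using sets.sets_into_space[OF assms(1)] by auto
  finally show "prob (space M - A - B - C) = 1 - prob A - prob B - prob C
      + prob (A \<inter> B) + prob (A \<inter> C) + prob (B \<inter> C) - prob (A \<inter> B \<inter> C)"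
    using two[of A B C] two[of "space M" B C] by (simp add: prob_space)
qed

section \<open>Enumeration of the eight graphs\<close>

lemma sum_Pow_insert:
  assumes "finite A" "a \<notin> A"
  shows "sum f (Pow (insert a A)) = sum f (Pow A) + (\<Sum>B\<in>Pow A. f (insert a B))"
proof -
  have "inj_on (insert a) (Pow A)" using assms(2) by (auto simp: inj_on_def)
  then show ?thesis
    unfolding Pow_insert using assms by (subst sum.union_disjoint) (auto simp: sum.reindex)
qed

lemma labelled_graphs_123:
  "labelled_graphs {1, 2, 3::nat} = Pow {{1, 2}, {1, 3}, {2, 3}}"
proof -
  have "{e. e \<subseteq> {1, 2, 3::nat} \<and> card e = 2} = {{1, 2}, {1, 3}, {2, 3}}"
  proof (intro equalityI subsetI)
    fix e assume "e \<in> {e. e \<subseteq> {1, 2, 3::nat} \<and> card e = 2}"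
    then show "e \<in> {{1, 2}, {1, 3}, {2, 3}}" by (auto simp: card_2_iff)
  qed auto
  then show ?thesis by (simp add: labelled_graphs_def)
qed

lemma hard_rgg_123_eq_iff:
  fixes X :: "nat \<Rightarrow> 'a \<Rightarrow> real"
  assumes "g \<subseteq> {{1, 2}, {1, 3}, {2, 3}}"
  shows "hard_rgg {1, 2, 3} X r \<omega> = g \<longleftrightarrow>
    (torus_dist (X 1 \<omega>) (X 2 \<omega>) \<le> r \<longleftrightarrow> {1, 2} \<in> g) \<and>
    (torus_dist (X 1 \<omega>) (X 3 \<omega>) \<le> r \<longleftrightarrow> {1, 3} \<in> g) \<and>
    (torus_dist (X 2 \<omega>) (X 3 \<omega>) \<le> r \<longleftrightarrow> {2, 3} \<in> g)"
proof -
  have sym: "torus_dist x y = torus_dist y x" for x y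
    by (simp add: torus_dist_def abs_minus_commute)
  have sub: "hard_rgg {1, 2, 3} X r \<omega> \<subseteq> {{1, 2}, {1, 3}, {2, 3}}"
    by (auto simp: hard_rgg_def)
  have mem: "{i, j} \<in> hard_rgg {1, 2, 3} X r \<omega> \<longleftrightarrow> torus_dist (X i \<omega>) (X j \<omega>) \<le> r"
    if "i \<in> {1, 2, 3}" "j \<in> {1, 2, 3}" "i \<noteq> j" for i j
    using that sym by (auto simp: hard_rgg_def doubleton_eq_iff)
  have "hard_rgg {1, 2, 3} X r \<omega> = g \<longleftrightarrow>
    (\<forall>e \<in> {{1, 2}, {1, 3}, {2, 3}}. e \<in> hard_rgg {1, 2, 3} X r \<omega> \<longleftrightarrow> e \<in> g)"
    using sub assms by blast
  then show ?thesis using mem[of 1 2] mem[of 1 3] mem[of 2 3] by simp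
qed

text \<open>A graph is encoded by three truth values, one for each possible edge, so the eight terms
  can be expanded by simplification.\<close>

lemma graph_entropy_123:
  fixes M :: "'a measure" and X :: "nat \<Rightarrow> 'a \<Rightarrow> real" and r :: real
  defines "h \<equiv> \<lambda>a b c. let p = measure M {\<omega> \<in> space M. (torus_dist (X 1 \<omega>) (X 2 \<omega>) \<le> r \<longleftrightarrow> a) \<and>
    (torus_dist (X 1 \<omega>) (X 3 \<omega>) \<le> r \<longleftrightarrow> b) \<and> (torus_dist (X 2 \<omega>) (X 3 \<omega>) \<le> r \<longleftrightarrow> c)} in p * log 2 p"
  shows "graph_entropy M {1, 2, 3} X r = - (\<Sum>a\<in>UNIV. \<Sum>b\<in>UNIV. \<Sum>c\<in>UNIV. h a b c)"
proof -
  let ?E = "{{1, 2}, {1, 3}, {2, 3}} :: nat set set"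
  have "graph_entropy M {1, 2, 3} X r = - (\<Sum>g\<in>Pow ?E. h ({1, 2} \<in> g) ({1, 3} \<in> g) ({2, 3} \<in> g))"
    unfolding graph_entropy_def graph_prob_def labelled_graphs_123 h_def Let_def
    by (intro arg_cong[where f = uminus] sum.cong refl) (simp only: Pow_iff hard_rgg_123_eq_iff)
  then show ?thesis
    by (simp add: sum_Pow_insert doubleton_eq_iff UNIV_bool)
qed

context uniform_torus_points
begin

text \<open>Inclusion and exclusion expresses all eight probabilities through \<open>r\<close> and
  the triangle probability \<open>t\<close>, so one formula serves both regimes.\<close>

lemma graph_entropy_eq:
  assumes I: "I = {1, 2, 3}" and r: "0 \<le> r" "r < 1/2"
  defines "t \<equiv> 3 * r^2 + (max 0 (3 * r - 1))^2"
  shows "graph_entropy M {1, 2, 3} X r =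
    - ((1 - 6 * r + 12 * r^2 - t) * log 2 (1 - 6 * r + 12 * r^2 - t))
    - 3 * (2 * r - 8 * r^2 + t) * log 2 (2 * r - 8 * r^2 + t)
    - 3 * (4 * r^2 - t) * log 2 (4 * r^2 - t)
    - t * log 2 t"
proof -
  let ?A = "near r 1 2" and ?B = "near r 1 3" and ?C = "near r 2 3"
  note ev = near_measurable[of 1 2 r] near_measurable[of 1 3 r] near_measurable[of 2 3 r]
  have swap: "near r i j = near r j i" for i j
    by (simp add: torus_dist_def abs_minus_commute)
  have p: "prob ?A = 2 * r" "prob ?B = 2 * r" "prob ?C = 2 * r"
    using prob_near[of 1 2 3 r] prob_near[of 1 3 2 r] prob_near[of 2 3 1 r] I r by auto
  have pp: "prob (?A \<inter> ?B) = 4 * r^2" "prob (?A \<inter> ?C) = 4 * r^2" "prob (?B \<inter> ?C) = 4 * r^2"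
    using prob_near_near[of 1 2 3 r] prob_near_near[of 2 1 3 r] prob_near_near[of 3 1 2 r] I r
    by (simp_all add: swap[of 2 1] swap[of 3 1] swap[of 3 2])
  have ppp: "prob (?A \<inter> ?B \<inter> ?C) = t"
    using prob_triangle[of 1 2 3 r] I r by (simp add: t_def)
  note ie = prob_inclusion_exclusion_three
  have abc: "prob (?A \<inter> ?B - ?C) = 4 * r^2 - t" "prob (?A \<inter> ?C - ?B) = 4 * r^2 - t"
    "prob (?B \<inter> ?C - ?A) = 4 * r^2 - t"
    "prob (?A - ?B - ?C) = 2 * r - 8 * r^2 + t" "prob (?B - ?A - ?C) = 2 * r - 8 * r^2 + t"
    "prob (?C - ?A - ?B) = 2 * r - 8 * r^2 + t"
    "prob (space M - ?A - ?B - ?C) = 1 - 6 * r + 12 * r^2 - t"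
    using ie(1)[of ?A ?B ?C] ie(1)[of ?A ?C ?B] ie(1)[of ?B ?C ?A] ie(2)[of ?A ?B ?C]
      ie(2)[of ?B ?A ?C] ie(2)[of ?C ?A ?B] ie(3)[of ?A ?B ?C] ev p pp ppp I
    by (simp_all add: Int_ac)
  have events:
    "{\<omega> \<in> space M. torus_dist (X 1 \<omega>) (X 2 \<omega>) \<le> r \<and> torus_dist (X 1 \<omega>) (X 3 \<omega>) \<le> r \<and>
       torus_dist (X 2 \<omega>) (X 3 \<omega>) \<le> r} = ?A \<inter> ?B \<inter> ?C"
    "{\<omega> \<in> space M. torus_dist (X 1 \<omega>) (X 2 \<omega>) \<le> r \<and> torus_dist (X 1 \<omega>) (X 3 \<omega>) \<le> r \<and>
       \<not> torus_dist (X 2 \<omega>) (X 3 \<omega>) \<le> r} = ?A \<inter> ?B - ?C"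
    "{\<omega> \<in> space M. torus_dist (X 1 \<omega>) (X 2 \<omega>) \<le> r \<and> \<not> torus_dist (X 1 \<omega>) (X 3 \<omega>) \<le> r \<and>
       torus_dist (X 2 \<omega>) (X 3 \<omega>) \<le> r} = ?A \<inter> ?C - ?B"
    "{\<omega> \<in> space M. \<not> torus_dist (X 1 \<omega>) (X 2 \<omega>) \<le> r \<and> torus_dist (X 1 \<omega>) (X 3 \<omega>) \<le> r \<and>
       torus_dist (X 2 \<omega>) (X 3 \<omega>) \<le> r} = ?B \<inter> ?C - ?A"
    "{\<omega> \<in> space M. torus_dist (X 1 \<omega>) (X 2 \<omega>) \<le> r \<and> \<not> torus_dist (X 1 \<omega>) (X 3 \<omega>) \<le> r \<and>
       \<not> torus_dist (X 2 \<omega>) (X 3 \<omega>) \<le> r} = ?A - ?B - ?C"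
    "{\<omega> \<in> space M. \<not> torus_dist (X 1 \<omega>) (X 2 \<omega>) \<le> r \<and> torus_dist (X 1 \<omega>) (X 3 \<omega>) \<le> r \<and>
       \<not> torus_dist (X 2 \<omega>) (X 3 \<omega>) \<le> r} = ?B - ?A - ?C"
    "{\<omega> \<in> space M. \<not> torus_dist (X 1 \<omega>) (X 2 \<omega>) \<le> r \<and> \<not> torus_dist (X 1 \<omega>) (X 3 \<omega>) \<le> r \<and>
       torus_dist (X 2 \<omega>) (X 3 \<omega>) \<le> r} = ?C - ?A - ?B"
    "{\<omega> \<in> space M. \<not> torus_dist (X 1 \<omega>) (X 2 \<omega>) \<le> r \<and> \<not> torus_dist (X 1 \<omega>) (X 3 \<omega>) \<le> r \<and>
       \<not> torus_dist (X 2 \<omega>) (X 3 \<omega>) \<le> r} = space M - ?A - ?B - ?C"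
    by auto
  show ?thesis
    \<comment> \<open>The rule \<open>not_le\<close> is switched off so that the negated comparisons
      still match \<open>events\<close>.\<close>
    unfolding graph_entropy_123 UNIV_bool Let_def
    by (simp add: events abc ppp algebra_simps del: not_le)
qed

text \<open>\<open>torus_dist\<close> never exceeds 1/2, so the complete graph is certain and every
  probability is 0 or 1.\<close>

lemma graph_entropy_complete:
  assumes "1/2 \<le> r"
  shows "graph_entropy M {1, 2, 3} X r = 0"
proof -
  have "torus_dist x y \<le> r" for x y
    using assms by (auto simp: torus_dist_def min_def)
  then have "{\<omega> \<in> space M. (torus_dist (X 1 \<omega>) (X 2 \<omega>) \<le> r \<longleftrightarrow> a) \<and>
    (torus_dist (X 1 \<omega>) (X 3 \<omega>) \<le> r \<longleftrightarrow> b) \<and> (torus_dist (X 2 \<omega>) (X 3 \<omega>) \<le> r \<longleftrightarrow> c)} \<in> {{}, space M}" for a b c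
    by auto
  moreover have "prob S * log 2 (prob S) = 0" if "S \<in> {{}, space M}" for S
    using that by (auto simp: prob_space)
  ultimately show ?thesis
    unfolding graph_entropy_123 Let_def by (simp only: sum.neutral_const minus_zero)
qed

lemma graph_entropy_cases:
  assumes I: "I = {1, 2, 3}" and r: "0 \<le> r"
  shows "graph_entropy M {1, 2, 3} X r =
    (if 0 < r \<and> r < 1/3 then H_less r else if 1/3 \<le> r \<and> r \<le> 1/2 then H_greater r else 0)"
proof -
  consider "r = 0" | "0 < r" "r < 1/3" | "1/3 \<le> r" "r < 1/2" | "r = 1/2" | "1/2 < r"
    using r by linarith
  then show ?thesis
  proof cases
    case 1
    then show ?thesis using graph_entropy_eq[OF I, of r] by simp
  next
    case 2
    then have "max 0 (3 * r - 1) = 0" by simp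
    moreover have "1 - 6 * r + 12 * r^2 - 3 * r^2 = (1 - 3 * r)^2" "2 * r - 8 * r^2 + 3 * r^2 = 2 * r - 5 * r^2"
      by (simp_all add: power2_eq_square algebra_simps)
    ultimately show ?thesis using graph_entropy_eq[OF I, of r] 2 by (simp add: H_less_def)
  next
    case 3
    then have t: "3 * r^2 + (max 0 (3 * r - 1))^2 = 12 * r^2 - 6 * r + 1"
      by (simp add: max_def power2_eq_square algebra_simps)
    have p: "1 - 6 * r + 12 * r^2 - (12 * r^2 - 6 * r + 1) = 0"
      "2 * r - 8 * r^2 + (12 * r^2 - 6 * r + 1) = (2 * r - 1)^2"
      "4 * r^2 - (12 * r^2 - 6 * r + 1) = 6 * r - 1 - 8 * r^2"
      by (simp_all add: power2_eq_square algebra_simps)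
    have "graph_entropy M {1, 2, 3} X r = H_greater r"
      using graph_entropy_eq[OF I r] 3(2) unfolding t p H_greater_def by simp
    then show ?thesis using 3 by simp
  next
    case 4
    \<comment> \<open>At this radius the graph is already complete, so the formula has to give the
      value 0.\<close>
    have "H_greater (1/2) = 0" by (simp add: H_greater_def power2_eq_square)
    then show ?thesis using graph_entropy_complete[of "1/2"] unfolding 4 by simp
  next
    case 5
    then show ?thesis using graph_entropy_complete[of r] by simp
  qed
qed

lemma graph_entropy_less_quarter:
  assumes I: "I = {1, 2, 3}" and r: "0 \<le> r" "r \<noteq> 1/4"
  shows "graph_entropy M {1, 2, 3} X r < graph_entropy M {1, 2, 3} X (1/4)"
proof -
  \<comment> \<open>Covers the radii at which the entropy is 0.\<close>
  have "0 < H_less (1/4)" using log2_three_less by (simp add: H_less_quarter)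
  then show ?thesis
    using r H_less_less_quarter[of r] H_greater_less_quarter[of r]
    by (simp add: graph_entropy_cases[OF I])
qed

end

theorem mainTheorem5:
  fixes M :: "'a measure" and X :: "nat \<Rightarrow> 'a \<Rightarrow> real"
  assumes "prob_space M"
    and "prob_space.indep_vars M (\<lambda>_. borel) X {1, 2, 3}"
    and "\<And>i. i \<in> {1, 2, 3} \<Longrightarrow> distr M borel (X i) = uniform_measure lborel {0..1}"
  shows "(\<forall>r\<ge>0. graph_entropy M {1, 2, 3} X r =
            (if 0 < r \<and> r < 1/3 then H_less r
             else if 1/3 \<le> r \<and> r \<le> 1/2 then H_greater r
             else 0))
       \<and> (\<forall>r. is_arg_max (graph_entropy M {1, 2, 3} X) (\<lambda>r. 0 \<le> r) r \<longleftrightarrow> r = 1/4)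
       \<and> max_connection_prob M {1, 2, 3} X = 1/2"
proof -
  interpret prob_space M by fact
  interpret uniform_torus_points M X "{1, 2, 3}"
    by standard (use assms in auto)
  \<comment> \<open>The strict inequality makes the maximiser unique, which lets the definite
    description in \<open>max_connection_prob\<close> evaluate to 1/4.\<close>
  have max: "is_arg_max (graph_entropy M {1, 2, 3} X) (\<lambda>r. 0 \<le> r) r \<longleftrightarrow> r = 1/4" for r
    unfolding is_arg_max_def
    using graph_entropy_less_quarter[of r] graph_entropy_less_quarter
    by (smt (verit) divide_nonneg_nonneg)
  have "prob (near (1/4) 1 2) = 1/2"
    using prob_near[of 1 2 3 "1/4"] by simp
  then have "max_connection_prob M {1, 2, 3} X = 1/2"
    by (simp only: max_connection_prob_def max the_eq_trivial avg_connection_prob_def)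
  then show ?thesis using max graph_entropy_cases by blast
qed

end
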